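(* Let $\mathcal{R}$ be a commutative ring containing $\mathbb{Q}$, let $\phi(x)=\sum_{k\ge0}\phi[k]\frac{x^k}{k!}\in\mathcal{R}[[x]]$, let $n\ge1$, and let $\mathcal{T}_n^{\phi}=\Delta_n^{\phi}x_0$. Then $\mathcal{T}^\phi_n=\mathcal{T}_n^{\phi}(x_1,\dots,x_n)$ is the exponential generating function of the $\phi$-enriched increasing trees with $n$ internal vertices, enumerated by the heights of their leaves. That is, writing $\mathcal{T}_n^{\phi}=\sum_{\mathbf{k}}\mathcal{T}_n^\phi[\mathbf{k}]\frac{x_1^{k_1}\cdots x_n^{k_n}}{k_1!\cdots k_n!}$, for every $\mathbf{k}=(k_1,\dots,k_n)\in\mathbb{N}^n$ and every colored set $(V,\kappa)$ with $\kappa:V\to\{1,\dots,n\}$ and $|\kappa^{-1}(i)|=k_i$ for $i=1,\dots,n$, one has $$\mathcal{T}_n^\phi[\mathbf{k}]=\sum_{T}\ \prod_{v\in[n]}\phi\big[\,|T^{-1}(v)|\,\big],$$ where $T$ ranges over the increasing trees with set of internal vertices $[n]$ and set of leaves $V$ in which each leaf $v\in V$ has height $\kappa(v)$ (so that $T$ has $k_i$ leaves of height $i$).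
   Context: With $\partial_k=\partial/\partial x_k$, put $\mathcal{D}_m^{\phi}=\sum_{k=0}^{m-1}\phi(x_{k+1})\partial_k:\mathcal{R}[[x_0,\dots,x_{m-1}]]\to\mathcal{R}[[x_0,\dots,x_m]]$ and $\Delta_n^\phi=\mathcal{D}_n^\phi\mathcal{D}_{n-1}^\phi\cdots\mathcal{D}_1^\phi$. An increasing tree with set of internal vertices $[n]=\{1,\dots,n\}$ and set of leaves $V$ is a (non-plane) rooted tree on the vertex set $[n]\uplus V$ whose root is in $[n]$, in which the elements of $V$ have no children, and such that the labels of internal vertices increase along each path from the root. (Internal vertices are a distinguished sort of vertex and are allowed to have no children; such a vertex contributes the factor $\phi[0]$.) $T^{-1}(v)$ is the set of children (internal vertices and leaves) of $v$; the height of a vertex is its distance to the root. *)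

theory Defs
  imports
    Complex_Main
    "HOL-Library.Poly_Mapping"
    "HOL-Library.FuncSet"
    "HOL-Computational_Algebra.Formal_Power_Series"
begin

definition rat_embedding :: "(rat \<Rightarrow> 'a::comm_ring_1) \<Rightarrow> bool" where
  "rat_embedding \<iota> \<longleftrightarrow> inj \<iota> \<and> \<iota> 1 = 1 \<and>
     (\<forall>p q. \<iota> (p + q) = \<iota> p + \<iota> q) \<and> (\<forall>p q. \<iota> (p * q) = \<iota> p * \<iota> q)"

lemma rat_embedding_of_nat:
  assumes "rat_embedding \<iota>"
  shows "\<iota> (of_nat n) = of_nat n"
proof (induction n)
  case 0
  have "\<iota> (0 + 0) = \<iota> 0 + \<iota> 0"
    using assms unfolding rat_embedding_def by blast
  then show ?case by simp
next
  case (Suc n)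
  then show ?case using assms unfolding rat_embedding_def by simp
qed

definition egf :: "(rat \<Rightarrow> 'a::comm_ring_1) \<Rightarrow> (nat \<Rightarrow> 'a) \<Rightarrow> 'a fps" where
  "egf \<iota> c = Abs_fps (\<lambda>k. \<iota> (1 / fact k) * c k)"

text \<open>
  A monomial is a finitely supported exponent function, and a series is an arbitrary family of
  coefficients indexed by monomials. The rings \<open>R[[x\<^sub>i : i \<in> I]]\<close> are the subrings
  \<open>mfps_in I\<close> of this one ring.
\<close>

typedef 'a mfps = "UNIV :: ((nat \<Rightarrow>\<^sub>0 nat) \<Rightarrow> 'a) set"
  morphisms mfps_nth Abs_mfps ..

lemma mfps_nth_Abs [simp]: "mfps_nth (Abs_mfps f) = f"
  by (simp add: Abs_mfps_inverse)

lemma mfps_eqI: "(\<And>m. mfps_nth F m = mfps_nth G m) \<Longrightarrow> F = G"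
  by (metis ext mfps_nth_inject)

definition mfps_in :: "nat set \<Rightarrow> 'a::zero mfps set" where
  "mfps_in I = {F. \<forall>m. mfps_nth F m \<noteq> 0 \<longrightarrow> Poly_Mapping.keys m \<subseteq> I}"

definition mdecomp :: "(nat \<Rightarrow>\<^sub>0 nat) \<Rightarrow> ((nat \<Rightarrow>\<^sub>0 nat) \<times> (nat \<Rightarrow>\<^sub>0 nat)) set" where
  "mdecomp m = {(a, b). a + b = m}"

lemma finite_mdecomp [simp]: "finite (mdecomp m)"
proof -
  define N where "N = (\<Sum>x\<in>Poly_Mapping.keys m. Poly_Mapping.lookup m x)"
  define D where "D = {f :: nat \<Rightarrow> nat. \<forall>x. (x \<in> Poly_Mapping.keys m \<longrightarrow> f x \<in> {..N}) \<and>
                                  (x \<notin> Poly_Mapping.keys m \<longrightarrow> f x = 0)}"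
  have "finite D"
    unfolding D_def by (rule finite_set_of_finite_funs) auto
  have bound: "Poly_Mapping.lookup m x \<le> N" if "x \<in> Poly_Mapping.keys m" for x
    unfolding N_def using that by (intro member_le_sum) auto
  have in_D: "Poly_Mapping.lookup a \<in> D" if "a + b = m \<or> b + a = m" for a b
  proof -
    have le: "Poly_Mapping.lookup a x \<le> Poly_Mapping.lookup m x" for x
      using that by (auto simp: lookup_add)
    have "Poly_Mapping.lookup a x \<le> N" if "x \<in> Poly_Mapping.keys m" for x
      using le[of x] bound[OF that] by linarith
    moreover have "Poly_Mapping.lookup a x = 0" if "x \<notin> Poly_Mapping.keys m" for x
      using le[of x] that by (simp add: in_keys_iff)
    ultimately show ?thesis
      unfolding D_def by blast
  qed
  have "inj_on (\<lambda>(a, b). (Poly_Mapping.lookup a, Poly_Mapping.lookup b)) (mdecomp m)"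
    by (auto simp: inj_on_def intro: poly_mapping_eqI)
  moreover have "(\<lambda>(a, b). (Poly_Mapping.lookup a, Poly_Mapping.lookup b)) ` mdecomp m \<subseteq> D \<times> D"
    using in_D by (auto simp: mdecomp_def)
  ultimately show ?thesis
    using \<open>finite D\<close> by (meson finite_SigmaI finite_imageD finite_subset)
qed

instantiation mfps :: (comm_ring_1) comm_ring_1
begin

definition "0 = Abs_mfps (\<lambda>m. 0)"
definition "1 = Abs_mfps (\<lambda>m. if m = 0 then 1 else 0)"
definition "F + G = Abs_mfps (\<lambda>m. mfps_nth F m + mfps_nth G m)"
definition "F - G = Abs_mfps (\<lambda>m. mfps_nth F m - mfps_nth G m)"
definition "- F = Abs_mfps (\<lambda>m. - mfps_nth F m)"
definition "F * G = Abs_mfps (\<lambda>m. \<Sum>(a, b)\<in>mdecomp m. mfps_nth F a * mfps_nth G b)"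

instance
proof
  fix F G H :: "'a mfps"
  note defs = zero_mfps_def one_mfps_def plus_mfps_def minus_mfps_def uminus_mfps_def
    times_mfps_def
  show "F + G + H = F + (G + H)" "F + G = G + F" "0 + F = F" "- F + F = 0" "F - G = F + - G"
    by (rule mfps_eqI; simp add: defs algebra_simps)+
  show "(0 :: 'a mfps) \<noteq> 1"
  proof
    assume "(0 :: 'a mfps) = 1"
    then have "mfps_nth (0 :: 'a mfps) 0 = mfps_nth 1 0" by simp
    then show False by (simp add: defs)
  qed
  show "(F + G) * H = F * H + G * H"
    by (rule mfps_eqI)
       (simp add: defs ring_distribs sum.distrib case_prod_unfold)
  show "F * G = G * F"
  proof (rule mfps_eqI)
    fix m
    show "mfps_nth (F * G) m = mfps_nth (G * F) m"
      unfolding defs mfps_nth_Abs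
      by (rule sum.reindex_bij_witness[where i = prod.swap and j = prod.swap])
         (auto simp: mdecomp_def algebra_simps)
  qed
  show "1 * F = F"
  proof (rule mfps_eqI)
    fix m
    have "mfps_nth (1 * F) m =
        (\<Sum>p\<in>mdecomp m. if fst p = 0 then mfps_nth F (snd p) else 0)"
      by (auto simp: defs case_prod_unfold intro!: sum.cong)
    also have "\<dots> = (\<Sum>p\<in>{(0 :: nat \<Rightarrow>\<^sub>0 nat, m)}. if fst p = 0 then mfps_nth F (snd p) else 0)"
      by (rule sum.mono_neutral_right, rule finite_mdecomp, auto simp: mdecomp_def)
    finally show "mfps_nth (1 * F) m = mfps_nth F m" by simp
  qed
  show "F * G * H = F * (G * H)"
  proof (rule mfps_eqI)
    fix m
    have "mfps_nth (F * G * H) m =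
        (\<Sum>p\<in>mdecomp m. \<Sum>q\<in>mdecomp (fst p).
           mfps_nth F (fst q) * mfps_nth G (snd q) * mfps_nth H (snd p))"
      by (simp add: defs case_prod_unfold sum_distrib_right)
    also have "\<dots> = (\<Sum>(p, q)\<in>Sigma (mdecomp m) (\<lambda>p. mdecomp (fst p)).
           mfps_nth F (fst q) * mfps_nth G (snd q) * mfps_nth H (snd p))"
      by (rule sum.Sigma) auto
    also have "\<dots> = (\<Sum>(p, q)\<in>Sigma (mdecomp m) (\<lambda>p. mdecomp (snd p)).
           mfps_nth F (fst p) * (mfps_nth G (fst q) * mfps_nth H (snd q)))"
      by (rule sum.reindex_bij_witness
            [where j = "\<lambda>((p, c), (a, b)). ((a, b + c), (b, c))"
               and i = "\<lambda>((a, p), (b, c)). ((a + b, c), (a, b))"])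
         (auto simp: mdecomp_def algebra_simps)
    also have "\<dots> = (\<Sum>p\<in>mdecomp m. \<Sum>q\<in>mdecomp (snd p).
           mfps_nth F (fst p) * (mfps_nth G (fst q) * mfps_nth H (snd q)))"
      by (rule sum.Sigma[symmetric]) auto
    also have "\<dots> = mfps_nth (F * (G * H)) m"
      by (simp add: defs case_prod_unfold sum_distrib_left)
    finally show "mfps_nth (F * G * H) m = mfps_nth (F * (G * H)) m" .
  qed
qed

end

definition mfps_X :: "nat \<Rightarrow> 'a::comm_ring_1 mfps" where
  "mfps_X i = Abs_mfps (\<lambda>m. if m = Poly_Mapping.single i 1 then 1 else 0)"

text \<open>\<open>\<phi>(x\<^sub>i)\<close>: only pure powers of \<open>x\<^sub>i\<close> (including \<open>1\<close>) occur.\<close>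

definition fps_at_X :: "'a::comm_ring_1 fps \<Rightarrow> nat \<Rightarrow> 'a mfps" where
  "fps_at_X \<phi> i = Abs_mfps (\<lambda>m. if Poly_Mapping.keys m \<subseteq> {i}
                                    then fps_nth \<phi> (Poly_Mapping.lookup m i) else 0)"

definition mfps_deriv :: "nat \<Rightarrow> 'a::comm_ring_1 mfps \<Rightarrow> 'a mfps" where
  "mfps_deriv k F = Abs_mfps (\<lambda>m. of_nat (Poly_Mapping.lookup m k + 1) *
                                   mfps_nth F (m + Poly_Mapping.single k 1))"

definition mfact :: "(nat \<Rightarrow>\<^sub>0 nat) \<Rightarrow> 'b::{comm_semiring_1,semiring_char_0}" where
  "mfact m = (\<Prod>i\<in>Poly_Mapping.keys m. fact (Poly_Mapping.lookup m i))"

text \<open>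
  The coefficient \<open>F[k]\<close> in the exponential expansion \<open>F = \<Sum>\<^sub>k F[k] x\<^sup>k / k!\<close>; see
  \<open>mfps_egf_coeff_iff\<close> below.
\<close>

definition mfps_egf_coeff :: "'a::comm_ring_1 mfps \<Rightarrow> (nat \<Rightarrow>\<^sub>0 nat) \<Rightarrow> 'a" where
  "mfps_egf_coeff F k = of_nat (mfact k) * mfps_nth F k"

lemma mfps_egf_coeff_iff:
  assumes "rat_embedding \<iota>"
  shows "mfps_egf_coeff F k = c \<longleftrightarrow> mfps_nth F k = \<iota> (1 / mfact k) * c"
proof -
  have "(mfact k :: rat) = of_nat (mfact k)"
    by (simp add: mfact_def)
  moreover have "(mfact k :: rat) \<noteq> 0"
    by (simp add: mfact_def)
  ultimately have "\<iota> 1 = \<iota> (1 / mfact k * of_nat (mfact k))"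
    by simp
  also have "\<dots> = \<iota> (1 / mfact k) * \<iota> (of_nat (mfact k))"
    using assms unfolding rat_embedding_def by blast
  finally have inv: "\<iota> (1 / mfact k) * of_nat (mfact k) = 1"
    using assms rat_embedding_of_nat[OF assms] unfolding rat_embedding_def by metis
  show ?thesis
    unfolding mfps_egf_coeff_def
  proof
    assume "of_nat (mfact k) * mfps_nth F k = c"
    then have "\<iota> (1 / mfact k) * c = \<iota> (1 / mfact k) * of_nat (mfact k) * mfps_nth F k"
      by (simp only: mult.assoc)
    then show "mfps_nth F k = \<iota> (1 / mfact k) * c"
      unfolding inv by simp
  next
    assume "mfps_nth F k = \<iota> (1 / mfact k) * c"
    then have "of_nat (mfact k) * mfps_nth F k = \<iota> (1 / mfact k) * of_nat (mfact k) * c"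
      by (simp only: mult.assoc mult.left_commute)
    then show "of_nat (mfact k) * mfps_nth F k = c"
      unfolding inv by simp
  qed
qed

definition D_op :: "'a::comm_ring_1 fps \<Rightarrow> nat \<Rightarrow> 'a mfps \<Rightarrow> 'a mfps" where
  "D_op \<phi> m F = (\<Sum>k<m. fps_at_X \<phi> (k + 1) * mfps_deriv k F)"

primrec Delta_op :: "'a::comm_ring_1 fps \<Rightarrow> nat \<Rightarrow> 'a mfps \<Rightarrow> 'a mfps" where
  "Delta_op \<phi> 0 F = F"
| "Delta_op \<phi> (Suc n) F = D_op \<phi> (Suc n) (Delta_op \<phi> n F)"

lemma mfps_nth_sum: "mfps_nth (sum F A) m = (\<Sum>x\<in>A. mfps_nth (F x) m)"
  by (induction A rule: infinite_finite_induct) (simp_all add: zero_mfps_def plus_mfps_def)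

lemma D_op_in:
  assumes "F \<in> mfps_in {..<m}"
  shows "D_op \<phi> m F \<in> mfps_in {..m}"
proof -
  have "Poly_Mapping.keys p \<subseteq> {..m}" if "mfps_nth (D_op \<phi> m F) p \<noteq> 0" for p
  proof -
    from that obtain k where k: "k < m"
      "mfps_nth (fps_at_X \<phi> (k + 1) * mfps_deriv k F) p \<noteq> 0"
      unfolding D_op_def mfps_nth_sum by (meson lessThan_iff sum.neutral)
    from k(2) obtain ab where ab: "ab \<in> mdecomp p"
      "mfps_nth (fps_at_X \<phi> (k + 1)) (fst ab) * mfps_nth (mfps_deriv k F) (snd ab) \<noteq> 0"
      unfolding times_mfps_def mfps_nth_Abs case_prod_unfold by (meson sum.neutral)
    define a b where "a = fst ab" and "b = snd ab"
    have p: "p = a + b"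
      using ab(1) by (auto simp: mdecomp_def a_def b_def)
    have a: "mfps_nth (fps_at_X \<phi> (k + 1)) a \<noteq> 0"
      using ab(2) unfolding a_def by (metis mult_zero_left)
    have b: "mfps_nth (mfps_deriv k F) b \<noteq> 0"
      using ab(2) unfolding b_def by (metis mult_zero_right)
    have "Poly_Mapping.keys a \<subseteq> {k + 1}"
      using a unfolding fps_at_X_def mfps_nth_Abs by meson
    then have "Poly_Mapping.keys a \<subseteq> {..m}"
      using k(1) by auto
    moreover have "mfps_nth F (b + Poly_Mapping.single k 1) \<noteq> 0"
      using b unfolding mfps_deriv_def mfps_nth_Abs by (metis mult_zero_right)
    then have keys: "Poly_Mapping.keys (b + Poly_Mapping.single k 1) \<subseteq> {..<m}"
      using assms unfolding mfps_in_def by blast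
    have "Poly_Mapping.keys b \<subseteq> {..m}"
    proof
      fix x assume "x \<in> Poly_Mapping.keys b"
      then have "x \<in> Poly_Mapping.keys (b + Poly_Mapping.single k 1)"
        by (simp add: in_keys_iff lookup_add)
      then show "x \<in> {..m}"
        using keys by (meson atMost_iff lessThan_iff less_imp_le subsetD)
    qed
    ultimately show ?thesis
      unfolding p using Poly_Mapping.keys_add[of a b] by blast
  qed
  then show ?thesis unfolding mfps_in_def by blast
qed

text \<open>
  A rooted tree on the vertex set \<open>X\<close> is given by its root \<open>r\<close> and the set \<open>E\<close> of its
  edges, each directed away from the root, so that \<open>(x, y) \<in> E\<close> means that \<open>y\<close> is a child of \<open>x\<close>.
\<close>

definition rooted_tree :: "'v set \<Rightarrow> 'v \<Rightarrow> ('v \<times> 'v) set \<Rightarrow> bool" where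
  "rooted_tree X r E \<longleftrightarrow> r \<in> X \<and> E \<subseteq> X \<times> X \<and> (\<forall>y. (y, r) \<notin> E) \<and>
     (\<forall>x\<in>X - {r}. \<exists>!y. (y, x) \<in> E) \<and> (\<forall>x\<in>X. (r, x) \<in> E\<^sup>*)"

definition children :: "('v \<times> 'v) set \<Rightarrow> 'v \<Rightarrow> 'v set" where
  "children E x = {y. (x, y) \<in> E}"

definition height :: "'v \<Rightarrow> ('v \<times> 'v) set \<Rightarrow> 'v \<Rightarrow> nat" where
  "height r E x = (LEAST h. (r, x) \<in> E ^^ h)"

text \<open>
  The vertex set is the disjoint sum \<open>{1..n} <+> V\<close>, with internal vertices \<open>Inl i\<close> and
  leaves \<open>Inr v\<close>.
\<close>

definition increasing_tree :: "nat \<Rightarrow> 'b set \<Rightarrow> nat + 'b \<Rightarrow> ((nat + 'b) \<times> (nat + 'b)) set \<Rightarrow> bool"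
  where
  "increasing_tree n V r E \<longleftrightarrow>
     rooted_tree ({1..n} <+> V) r E \<and> r \<in> Inl ` {1..n} \<and>
     (\<forall>v\<in>V. children E (Inr v) = {}) \<and>
     (\<forall>i j. (Inl i, Inl j) \<in> E\<^sup>+ \<longrightarrow> i < j)"

definition increasing_trees_with_heights ::
  "nat \<Rightarrow> 'b set \<Rightarrow> ('b \<Rightarrow> nat) \<Rightarrow> ((nat + 'b) \<times> ((nat + 'b) \<times> (nat + 'b)) set) set" where
  "increasing_trees_with_heights n V \<kappa> =
     {(r, E). increasing_tree n V r E \<and> (\<forall>v\<in>V. height r E (Inr v) = \<kappa> v)}"

lemma finite_increasing_trees_with_heights:
  assumes "finite V"
  shows "finite (increasing_trees_with_heights n V \<kappa>)"
proof (rule finite_subset)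
  show "increasing_trees_with_heights n V \<kappa> \<subseteq>
      ({1..n} <+> V) \<times> Pow (({1..n} <+> V) \<times> ({1..n} <+> V))"
    by (auto simp: increasing_trees_with_heights_def increasing_tree_def rooted_tree_def)
  show "finite (({1..n} <+> V) \<times> Pow (({1..n} <+> V) \<times> ({1..n} <+> V)))"
    using assms by simp
qed

end

theory Submission
  imports Defs
begin

text \<open>
  By the Leibniz rule, \<open>\<D>\<^sub>n\<^sub>+\<^sub>1\<close> acts on a product of derivatives \<open>\<phi>\<^sup>(\<^sup>c\<^sup>)(x\<^sub>h\<^sub>+\<^sub>1)\<close> by attaching
  a new vertex, of height \<open>h + 1\<close>, to the vertex of height \<open>h\<close> whose factor is differentiated. So
  \<open>\<Delta>\<^sub>n x\<^sub>0\<close> is the sum over the increasing trees on \<open>{1..n}\<close> without leaves of the product, over the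
  vertices \<open>i\<close>, of \<open>\<phi>\<^sup>(\<^sup>c\<^sup>)(x\<^sub>h\<^sub>+\<^sub>1)\<close> where \<open>c\<close> is the number of children and \<open>h\<close> the height of \<open>i\<close>.
  Extracting an exponential coefficient of such a product, again by differentiating once for each
  leaf, distributes the leaves \<open>v\<close> over the vertices of height \<open>\<kappa> v - 1\<close>.
\<close>

subsection \<open>Derivations of multivariate power series\<close>

lemma add_single_diff_single:
  assumes "Poly_Mapping.lookup a k \<noteq> 0"
  shows "a - Poly_Mapping.single k 1 + Poly_Mapping.single k (1::nat) = a"
  using assms by (intro poly_mapping_eqI) (auto simp: lookup_add lookup_minus lookup_single when_def)

text \<open>One half of the Leibniz rule. The weight removes the decompositions in which
  \<open>a\<close> is free of the \<open>k\<close>-th variable; lowering the \<open>k\<close>-th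
  exponent of \<open>a\<close> matches the others with the decompositions of
  \<open>m\<close>.\<close>

lemma sum_mdecomp_shift:
  fixes F G :: "'a::comm_ring_1 mfps"
  shows "(\<Sum>(a, b)\<in>mdecomp (m + Poly_Mapping.single k 1).
            of_nat (Poly_Mapping.lookup a k) * (mfps_nth F a * mfps_nth G b)) =
         mfps_nth (mfps_deriv k F * G) m"
proof -
  let ?e = "Poly_Mapping.single k (1::nat)"
  let ?h = "\<lambda>(a, b). of_nat (Poly_Mapping.lookup a k) * (mfps_nth F a * mfps_nth G b)"
  let ?S = "{p \<in> mdecomp (m + ?e). Poly_Mapping.lookup (fst p) k \<noteq> 0}"
  have "sum ?h (mdecomp (m + ?e)) = sum ?h ?S"
    by (rule sum.mono_neutral_right) (auto intro!: gr0I)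
  also have "\<dots> = (\<Sum>(a, b)\<in>mdecomp m.
      of_nat (Poly_Mapping.lookup a k + 1) * mfps_nth F (a + ?e) * mfps_nth G b)"
  proof (rule sum.reindex_bij_witness[where i = "\<lambda>(a, b). (a + ?e, b)"
        and j = "\<lambda>(a, b). (a - ?e, b)"])
    fix p assume p: "p \<in> ?S"
    obtain a b where ab: "p = (a, b)" by (cases p)
    have a: "a - ?e + ?e = a"
      using p ab by (intro add_single_diff_single) auto
    have "(a - ?e) + b + ?e = a - ?e + ?e + b"
      by (simp only: ac_simps)
    also have "\<dots> = m + ?e"
      unfolding a using p ab by (simp add: mdecomp_def)
    finally have "(a - ?e) + b + ?e = m + ?e" .
    then have "(a - ?e) + b = m" by simp
    then show "(\<lambda>(a, b). (a - ?e, b)) p \<in> mdecomp m"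
      by (simp add: ab mdecomp_def)
    show "(\<lambda>(a, b). (a + ?e, b)) ((\<lambda>(a, b). (a - ?e, b)) p) = p"
      using a by (simp add: ab)
    have "Poly_Mapping.lookup (a - ?e) k + 1 = Poly_Mapping.lookup a k"
      using p ab by (auto simp: lookup_minus)
    then show "(\<lambda>(a, b). of_nat (Poly_Mapping.lookup a k + 1) * mfps_nth F (a + ?e) * mfps_nth G b)
            ((\<lambda>(a, b). (a - ?e, b)) p) = ?h p"
      using a by (simp add: ab mult.assoc del: of_nat_Suc)
  next
    fix p assume p: "p \<in> mdecomp m"
    show "(\<lambda>(a, b). (a - ?e, b)) ((\<lambda>(a, b). (a + ?e, b)) p) = p"
      by (cases p) simp
    show "(\<lambda>(a, b). (a + ?e, b)) p \<in> ?S"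
      using p by (cases p) (auto simp: mdecomp_def lookup_add algebra_simps)
  qed
  also have "\<dots> = mfps_nth (mfps_deriv k F * G) m"
    by (simp add: times_mfps_def mfps_deriv_def)
  finally show ?thesis .
qed

text \<open>On a decomposition \<open>(a, b)\<close> of the exponent, the degree in the
  \<open>k\<close>-th variable is the sum of the degrees of \<open>a\<close> and \<open>b\<close>.
  Splitting the weight accordingly gives the two terms, the second after exchanging \<open>F\<close>
  and \<open>G\<close>.\<close>

lemma mfps_deriv_mult:
  "mfps_deriv k (F * G) = mfps_deriv k F * G + F * mfps_deriv k G"
proof (rule mfps_eqI)
  fix m
  let ?M = "mdecomp (m + Poly_Mapping.single k 1)"
  have deg: "of_nat (Poly_Mapping.lookup m k + 1) * (x::'a) =
      of_nat (Poly_Mapping.lookup a k) * x + of_nat (Poly_Mapping.lookup b k) * x"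
    if "(a, b) \<in> ?M" for a b x
  proof -
    have "Poly_Mapping.lookup (a + b) k = Poly_Mapping.lookup m k + 1"
      using that by (simp add: mdecomp_def lookup_add)
    then show ?thesis
      by (metis lookup_add of_nat_add distrib_right)
  qed
  have "mfps_nth (mfps_deriv k (F * G)) m =
      (\<Sum>(a, b)\<in>?M. of_nat (Poly_Mapping.lookup m k + 1) * (mfps_nth F a * mfps_nth G b))"
    unfolding mfps_deriv_def times_mfps_def mfps_nth_Abs sum_distrib_left case_prod_unfold ..
  also have "\<dots> = (\<Sum>(a, b)\<in>?M. of_nat (Poly_Mapping.lookup a k) * (mfps_nth F a * mfps_nth G b)) +
      (\<Sum>(a, b)\<in>?M. of_nat (Poly_Mapping.lookup b k) * (mfps_nth F a * mfps_nth G b))"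
    unfolding sum.distrib[symmetric] by (intro sum.cong) (auto simp only: deg split: prod.splits)
  also have "(\<Sum>(a, b)\<in>?M. of_nat (Poly_Mapping.lookup b k) * (mfps_nth F a * mfps_nth G b)) =
      (\<Sum>(a, b)\<in>?M. of_nat (Poly_Mapping.lookup a k) * (mfps_nth G a * mfps_nth F b))"
    by (rule sum.reindex_bij_witness[where i = prod.swap and j = prod.swap])
      (auto simp: mdecomp_def add.commute mult.commute)
  finally show "mfps_nth (mfps_deriv k (F * G)) m =
      mfps_nth (mfps_deriv k F * G + F * mfps_deriv k G) m"
    unfolding sum_mdecomp_shift by (simp add: plus_mfps_def mult.commute)
qed

lemma mfps_deriv_one [simp]: "mfps_deriv k 1 = 0"
proof (rule mfps_eqI)
  fix m :: "nat \<Rightarrow>\<^sub>0 nat"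
  have "Poly_Mapping.lookup (m + Poly_Mapping.single k 1) k \<noteq> Poly_Mapping.lookup 0 k"
    by (simp add: lookup_add)
  then have "m + Poly_Mapping.single k 1 \<noteq> 0" by metis
  then show "mfps_nth (mfps_deriv k 1) m = mfps_nth (0::'a mfps) m"
    by (simp add: mfps_deriv_def one_mfps_def zero_mfps_def)
qed

text \<open>Each summand remains a product over all of \<open>I\<close>, so that differentiating the
  products below gives products of the same shape.\<close>

lemma mfps_deriv_prod:
  assumes "finite I"
  shows "mfps_deriv k (\<Prod>i\<in>I. F i) = (\<Sum>j\<in>I. \<Prod>i\<in>I. if i = j then mfps_deriv k (F j) else F i)"
  using assms
proof (induction I rule: finite_induct)
  case (insert a I)
  have 1: "(\<Prod>i\<in>I. if i = a then mfps_deriv k (F a) else F i) = (\<Prod>i\<in>I. F i)"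
    using insert by (intro prod.cong) auto
  have 2: "(\<Sum>j\<in>I. \<Prod>i\<in>insert a I. if i = j then mfps_deriv k (F j) else F i) =
      F a * (\<Sum>j\<in>I. \<Prod>i\<in>I. if i = j then mfps_deriv k (F j) else F i)"
    unfolding sum_distrib_left using insert by (intro sum.cong) auto
  show ?case
    using insert 1 2 by (simp add: mfps_deriv_mult)
qed simp

lemma mfps_deriv_sum: "mfps_deriv k (\<Sum>x\<in>A. F x) = (\<Sum>x\<in>A. mfps_deriv k (F x))"
  by (rule mfps_eqI) (simp add: mfps_deriv_def mfps_nth_sum sum_distrib_left)

lemma D_op_sum: "D_op \<phi> m (\<Sum>x\<in>A. F x) = (\<Sum>x\<in>A. D_op \<phi> m (F x))"
  unfolding D_op_def mfps_deriv_sum sum_distrib_left by (rule sum.swap)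

section \<open>Constant terms and exponential coefficients\<close>

lemma mfps_nth_mult_0: "mfps_nth (F * G) 0 = mfps_nth F 0 * mfps_nth G 0"
proof -
  have "p = (0, 0)" if p: "p \<in> mdecomp 0" for p
  proof -
    obtain a b where ab: "p = (a, b)" by (cases p)
    have "Poly_Mapping.lookup a x + Poly_Mapping.lookup b x = 0" for x
      using p lookup_add[of a b x] by (simp add: ab mdecomp_def)
    then have "a = 0" "b = 0"
      by (intro poly_mapping_eqI; simp)+
    then show ?thesis by (simp add: ab)
  qed
  moreover have "(0, 0) \<in> mdecomp 0"
    by (simp add: mdecomp_def)
  ultimately have "mdecomp 0 = {(0, 0)}" by blast
  then show ?thesis by (simp add: times_mfps_def)
qed

lemma mfps_nth_prod_0: "mfps_nth (\<Prod>i\<in>I. F i) 0 = (\<Prod>i\<in>I. mfps_nth (F i) 0)"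
proof (induction I rule: infinite_finite_induct)
  case (insert x I)
  then show ?case by (simp add: mfps_nth_mult_0)
qed (simp_all add: one_mfps_def)

lemma mfact_add_single:
  "mfact (m + Poly_Mapping.single j 1) = mfact m * of_nat (Poly_Mapping.lookup m j + 1)"
proof -
  \<comment> \<open>The two exponents may have different supports. Both products are taken over one
    common set, where the additional factors are \<open>fact 0 = 1\<close>.\<close>
  have *: "mfact p = (\<Prod>i\<in>insert j (Poly_Mapping.keys m). fact (Poly_Mapping.lookup p i))"
    if "Poly_Mapping.keys p \<subseteq> insert j (Poly_Mapping.keys m)" for p
    unfolding mfact_def using that by (intro prod.mono_neutral_left) (auto simp: in_keys_iff)
  let ?K = "insert j (Poly_Mapping.keys m)"
  have "mfact (m + Poly_Mapping.single j 1) =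
      (\<Prod>i\<in>?K. fact (Poly_Mapping.lookup (m + Poly_Mapping.single j 1) i))"
    by (rule *) (auto simp: in_keys_iff lookup_add lookup_single when_def split: if_splits)
  also have "\<dots> = (\<Prod>i\<in>?K.
      fact (Poly_Mapping.lookup m i) * (if i = j then of_nat (Poly_Mapping.lookup m j + 1) else 1))"
    by (intro prod.cong) (simp_all add: lookup_add lookup_single when_def mult.commute)
  also have "\<dots> = (\<Prod>i\<in>?K. fact (Poly_Mapping.lookup m i)) * of_nat (Poly_Mapping.lookup m j + 1)"
    unfolding prod.distrib by (subst prod.delta) simp_all
  also have "(\<Prod>i\<in>?K. fact (Poly_Mapping.lookup m i)) = mfact m"
    by (rule *[symmetric]) auto
  finally show ?thesis .
qed

text \<open>The factor produced by differentiation is the quotient of the two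
  multifactorials.\<close>

lemma mfps_egf_coeff_deriv:
  "mfps_egf_coeff F (k + Poly_Mapping.single j 1) = mfps_egf_coeff (mfps_deriv j F) k"
  unfolding mfps_egf_coeff_def mfps_deriv_def mfact_add_single
  by (simp only: mfps_nth_Abs of_nat_mult of_nat_id mult.assoc)

section \<open>Series in a prescribed set of variables\<close>

lemma mfps_in_mult:
  assumes "F \<in> mfps_in I" "G \<in> mfps_in I"
  shows "F * G \<in> mfps_in I"
  unfolding mfps_in_def
proof safe
  fix m x assume m: "mfps_nth (F * G) m \<noteq> 0" and x: "x \<in> Poly_Mapping.keys m"
  obtain a b where ab: "a + b = m" "mfps_nth F a * mfps_nth G b \<noteq> 0"
    using m unfolding times_mfps_def mfps_nth_Abs mdecomp_def
    by (smt (verit, best) case_prodE mem_Collect_eq split_conv sum.neutral)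
  then have "mfps_nth F a \<noteq> 0" "mfps_nth G b \<noteq> 0" by auto
  then have "Poly_Mapping.keys a \<subseteq> I" "Poly_Mapping.keys b \<subseteq> I"
    using assms by (auto simp: mfps_in_def)
  then show "x \<in> I"
    using x Poly_Mapping.keys_add[of a b] ab(1) by blast
qed

lemma mfps_in_prod: "(\<And>i. i \<in> A \<Longrightarrow> F i \<in> mfps_in I) \<Longrightarrow> (\<Prod>i\<in>A. F i) \<in> mfps_in I"
proof (induction A rule: infinite_finite_induct)
  case (insert x A)
  then show ?case by (simp add: mfps_in_mult)
qed (auto simp: mfps_in_def one_mfps_def split: if_splits)

lemma mfps_in_sum:
  assumes "\<And>i. i \<in> A \<Longrightarrow> F i \<in> mfps_in I"
  shows "(\<Sum>i\<in>A. F i) \<in> mfps_in I"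
  unfolding mfps_in_def
proof (intro CollectI allI impI)
  fix m assume "mfps_nth (\<Sum>i\<in>A. F i) m \<noteq> 0"
  then obtain i where "i \<in> A" "mfps_nth (F i) m \<noteq> 0"
    unfolding mfps_nth_sum by (meson sum.neutral)
  then show "Poly_Mapping.keys m \<subseteq> I"
    using assms unfolding mfps_in_def by blast
qed

lemma fps_at_X_in: "i \<in> I \<Longrightarrow> fps_at_X \<phi> i \<in> mfps_in I"
  by (auto simp: mfps_in_def fps_at_X_def split: if_splits)

subsection \<open>Products of derivatives of the enriching series\<close>

text \<open>The \<open>s\<close>-th derivative of \<open>\<phi>\<close>, evaluated at the variable with index \<open>h\<close>.\<close>

definition egf_at :: "(rat \<Rightarrow> 'a::comm_ring_1) \<Rightarrow> (nat \<Rightarrow> 'a) \<Rightarrow> nat \<Rightarrow> nat \<Rightarrow> 'a mfps" where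
  "egf_at \<iota> c s h = fps_at_X (egf \<iota> (\<lambda>k. c (k + s))) h"

lemma egf_at_nth_0: "rat_embedding \<iota> \<Longrightarrow> mfps_nth (egf_at \<iota> c s h) 0 = c s"
  by (simp add: egf_at_def fps_at_X_def egf_def rat_embedding_def)

lemma mfps_deriv_egf_at:
  assumes "rat_embedding \<iota>"
  shows "mfps_deriv k (egf_at \<iota> c s h) = (if k = h then egf_at \<iota> c (Suc s) h else 0)"
proof (rule mfps_eqI)
  fix m
  let ?e = "Poly_Mapping.single k (1::nat)"
  show "mfps_nth (mfps_deriv k (egf_at \<iota> c s h)) m =
    mfps_nth (if k = h then egf_at \<iota> c (Suc s) h else 0) m"
  proof (cases "k = h")
    case False
    have "k \<in> Poly_Mapping.keys (m + ?e)"
      by (simp add: in_keys_iff lookup_add)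
    then have "\<not> Poly_Mapping.keys (m + ?e) \<subseteq> {h}"
      using False by auto
    then show ?thesis
      using False by (simp add: mfps_deriv_def egf_at_def fps_at_X_def zero_mfps_def)
  next
    case True
    have keys: "Poly_Mapping.keys (m + ?e) \<subseteq> {h} \<longleftrightarrow> Poly_Mapping.keys m \<subseteq> {h}"
      using True by (auto simp: in_keys_iff lookup_add lookup_single when_def subset_iff split: if_splits)
    let ?l = "Poly_Mapping.lookup m h"
    \<comment> \<open>The cancellation \<open>(l + 1) / (l + 1)! = 1 / l!\<close> takes place in the
      rationals and is carried over by \<iota>.\<close>
    have "of_nat (?l + 1) * \<iota> (1 / fact (?l + 1)) = \<iota> (of_nat (?l + 1) * (1 / fact (?l + 1)))"
      using assms rat_embedding_of_nat[OF assms] unfolding rat_embedding_def by metis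
    also have "of_nat (?l + 1) * (1 / fact (?l + 1)) = (1 / fact ?l :: rat)"
      by (simp add: field_simps del: of_nat_Suc)
    finally have "of_nat (?l + 1) * (\<iota> (1 / fact (?l + 1)) * x) = \<iota> (1 / fact ?l) * x" for x
      by (metis mult.assoc)
    then show ?thesis
      using True keys
      by (simp add: mfps_deriv_def egf_at_def fps_at_X_def egf_def lookup_add zero_mfps_def
          del: of_nat_Suc fact_Suc)
  qed
qed

text \<open>Only the factors in the \<open>k\<close>-th variable survive. Raising \<open>s j\<close>
  by one stands for giving the vertex \<open>j\<close> one more child.\<close>

lemma mfps_deriv_prod_egf_at:
  assumes "rat_embedding \<iota>" "finite I"
  shows "mfps_deriv k (\<Prod>i\<in>I. egf_at \<iota> c (s i) (h i)) =
    (\<Sum>j\<in>{j \<in> I. h j = k}. \<Prod>i\<in>I. egf_at \<iota> c ((s(j := Suc (s j))) i) (h i))"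
proof -
  have *: "(\<Prod>i\<in>I. if i = j then mfps_deriv k (egf_at \<iota> c (s j) (h j)) else egf_at \<iota> c (s i) (h i)) =
      (if h j = k then \<Prod>i\<in>I. egf_at \<iota> c ((s(j := Suc (s j))) i) (h i) else 0)" if "j \<in> I" for j
  proof (cases "h j = k")
    case True
    then show ?thesis
      by (auto simp: mfps_deriv_egf_at[OF assms(1)] intro!: prod.cong)
  next
    case False
    then have "mfps_deriv k (egf_at \<iota> c (s j) (h j)) = 0"
      by (simp add: mfps_deriv_egf_at[OF assms(1)])
    then show ?thesis
      using False that assms(2) by (auto intro!: prod_zero)
  qed
  show ?thesis
    unfolding mfps_deriv_prod[OF assms(2)]
    by (simp add: * sum.inter_filter[OF assms(2)] del: fun_upd_apply cong: sum.cong)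
qed

text \<open>Serves twice: for the vertex that receives a new leaf, and for the parent of a new
  internal vertex.\<close>

lemma sum_PiE_insert:
  assumes "x \<notin> S"
  shows "(\<Sum>g\<in>PiE (insert x S) T. F g) = (\<Sum>y\<in>T x. \<Sum>g\<in>PiE S T. F (g(x := y)))"
proof -
  have "(\<Sum>g\<in>PiE (insert x S) T. F g) = (\<Sum>(y, g)\<in>T x \<times> PiE S T. F (g(x := y)))"
    by (subst PiE_insert_eq, subst sum.reindex[OF inj_combinator[OF assms]])
      (simp add: comp_def case_prod_unfold)
  then show ?thesis
    by (simp only: sum.cartesian_product)
qed

text \<open>
  Passing from \<open>V\<close> to \<open>insert v V\<close> is one application of the derivative with respect to the
  variable \<open>\<kappa> v\<close>, and the factor hit by this derivative is the vertex to which \<open>v\<close> is attached.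
\<close>

lemma mfps_egf_coeff_prod_egf_at:
  assumes "rat_embedding \<iota>" "finite I" "finite V"
    and "\<And>i. card {v \<in> V. \<kappa> v = i} = Poly_Mapping.lookup k i"
  shows "mfps_egf_coeff (\<Prod>i\<in>I. egf_at \<iota> c (s i) (h i)) k =
    (\<Sum>g\<in>PiE V (\<lambda>v. {i \<in> I. h i = \<kappa> v}). \<Prod>i\<in>I. c (s i + card {v \<in> V. g v = i}))"
  using assms(3,4)
\<comment> \<open>Removing a leaf lowers \<open>k\<close> and raises \<open>s\<close> at the vertex
  that carried it, so both must vary.\<close>
proof (induction V arbitrary: k s rule: finite_induct)
  case empty
  then have "k = 0" by (intro poly_mapping_eqI) simp
  then show ?case
    by (simp add: mfps_egf_coeff_def mfact_def mfps_nth_prod_0 egf_at_nth_0[OF assms(1)])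
next
  case (insert v V)
  let ?T = "\<lambda>v. {i \<in> I. h i = \<kappa> v}"
  define k' where "k' = k - Poly_Mapping.single (\<kappa> v) 1"
  have card_v: "card {w \<in> insert v V. P w} = (if P v then Suc else id) (card {w \<in> V. P w})" for P
  proof (cases "P v")
    case True
    then have "{w \<in> insert v V. P w} = insert v {w \<in> V. P w}" by auto
    then show ?thesis using True insert by simp
  next
    case False
    then have "{w \<in> insert v V. P w} = {w \<in> V. P w}" by auto
    then show ?thesis using False by simp
  qed
  have k: "Poly_Mapping.lookup k i = (if i = \<kappa> v then Suc else id) (card {w \<in> V. \<kappa> w = i})" for i
    using insert.prems[of i] card_v[of "\<lambda>w. \<kappa> w = i"] by auto
  have k'k: "k = k' + Poly_Mapping.single (\<kappa> v) 1"
    unfolding k'_def by (rule add_single_diff_single[symmetric]) (simp add: k)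
  have IH: "mfps_egf_coeff (\<Prod>i\<in>I. egf_at \<iota> c (s' i) (h i)) k' =
    (\<Sum>g\<in>PiE V ?T. \<Prod>i\<in>I. c (s' i + card {v \<in> V. g v = i}))" for s'
    by (rule insert.IH) (auto simp: k'_def lookup_minus lookup_single k)
  have add: "mfps_egf_coeff (\<Sum>j\<in>J. F j) k' = (\<Sum>j\<in>J. mfps_egf_coeff (F j) k')"
    for J and F :: "'b \<Rightarrow> 'a mfps"
    by (simp add: mfps_egf_coeff_def mfps_nth_sum sum_distrib_left)
  have "mfps_egf_coeff (\<Prod>i\<in>I. egf_at \<iota> c (s i) (h i)) k =
    (\<Sum>j\<in>?T v. \<Sum>g\<in>PiE V ?T. \<Prod>i\<in>I. c ((s(j := Suc (s j))) i + card {v \<in> V. g v = i}))"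
    unfolding k'k mfps_egf_coeff_deriv mfps_deriv_prod_egf_at[OF assms(1,2)] add IH ..
  also have "\<dots> = (\<Sum>j\<in>?T v. \<Sum>g\<in>PiE V ?T.
      \<Prod>i\<in>I. c (s i + card {w \<in> insert v V. (g(v := j)) w = i}))"
  proof -
    have eq: "{w \<in> V. (g(v := j)) w = i} = {w \<in> V. g w = i}" for g j i
      using insert.hyps by auto
    then show ?thesis
      unfolding card_v eq by (intro sum.cong prod.cong refl arg_cong[of _ _ c]) simp
  qed
  finally show ?case
    unfolding sum_PiE_insert[OF insert.hyps(2)] .
qed

subsection \<open>Recursive trees\<close>

text \<open>
  A tree on \<open>{1..n}\<close> with increasing labels is encoded by its parent function on \<open>{2..n}\<close>.
\<close>

definition parent_maps :: "nat \<Rightarrow> (nat \<Rightarrow> nat) set" where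
  "parent_maps n = PiE {2..n} (\<lambda>i. {1..<i})"

text \<open>The guard only ensures termination; it fails at the root, where \<open>f\<close> is \<open>undefined\<close>.\<close>

function depth :: "(nat \<Rightarrow> nat) \<Rightarrow> nat \<Rightarrow> nat" where
  "depth f i = (if 1 \<le> f i \<and> f i < i then Suc (depth f (f i)) else 0)"
  by auto
termination by (relation "measure snd") auto

declare depth.simps [simp del]

lemma depth_1 [simp]: "depth f (Suc 0) = 0"
  by (subst depth.simps) simp

lemma parent_mapsD: "f \<in> parent_maps n \<Longrightarrow> i \<in> {2..n} \<Longrightarrow> 1 \<le> f i \<and> f i < i"
  unfolding parent_maps_def by (drule (1) PiE_mem) auto

lemma depth_parent:
  "f \<in> parent_maps n \<Longrightarrow> i \<in> {2..n} \<Longrightarrow> depth f i = Suc (depth f (f i))"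
  using parent_mapsD[of f n i] by (subst depth.simps) simp

text \<open>Labels decrease along the chain of parents and stay positive. The bound keeps all depths
  in the range of \<open>D_op\<close> and all variables among those with index \<open>1\<close> to
  \<open>n\<close>.\<close>

lemma depth_less: "i \<ge> 1 \<Longrightarrow> depth f i < i"
proof (induction i rule: less_induct)
  case (less i)
  show ?case
  proof (cases "1 \<le> f i \<and> f i < i")
    case True
    then have "depth f (f i) < f i"
      by (intro less.IH) auto
    then show ?thesis
      using True by (subst depth.simps) simp
  next
    case False
    then show ?thesis
      using less.prems by (subst depth.simps) auto
  qed
qed

text \<open>The recursion from \<open>i\<close> consults the parent function only at labels up to
  \<open>i\<close>. Hence attaching a vertex with the largest label preserves all earlier
  depths.\<close>

lemma depth_fun_upd:
  assumes "i < m"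
  shows "depth (f(m := j)) i = depth f i"
  using assms
proof (induction i rule: less_induct)
  case (less i)
  have "depth (f(m := j)) (f i) = depth f (f i)" if "f i < i"
    by (rule less.IH) (use that less.prems in auto)
  then show ?case
    using less.prems by (subst (1 2) depth.simps) auto
qed

text \<open>The variable index is the height of a child of \<open>i\<close>. The order of the
  derivative counts the internal children, while the powers of the variable make room for
  leaves.\<close>

definition tree_prod :: "(rat \<Rightarrow> 'a::comm_ring_1) \<Rightarrow> (nat \<Rightarrow> 'a) \<Rightarrow> nat \<Rightarrow> (nat \<Rightarrow> nat) \<Rightarrow> 'a mfps"
  where "tree_prod \<iota> c n f =
    (\<Prod>i\<in>{1..n}. egf_at \<iota> c (card {j \<in> {2..n}. f j = i}) (Suc (depth f i)))"

text \<open>The derivative in the \<open>k\<close>-th variable selects a vertex \<open>j\<close> of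
  depth \<open>k - 1\<close>. The accompanying factor in the variable \<open>k + 1\<close> belongs
  to the new vertex \<open>Suc n\<close>, which is childless and of depth \<open>k\<close>.\<close>

lemma D_op_tree_prod:
  assumes "rat_embedding \<iota>" "n \<ge> 1" "f \<in> parent_maps n"
  shows "D_op (egf \<iota> c) (Suc n) (tree_prod \<iota> c n f) =
    (\<Sum>j\<in>{1..n}. tree_prod \<iota> c (Suc n) (f(Suc n := j)))"
proof -
  let ?s = "\<lambda>i. card {j \<in> {2..n}. f j = i}" and ?h = "\<lambda>i. Suc (depth f i)"
  let ?P = "\<lambda>j. \<Prod>i\<in>{1..n}. egf_at \<iota> c ((?s(j := Suc (?s j))) i) (?h i)"
  have step: "tree_prod \<iota> c (Suc n) (f(Suc n := j)) = egf_at \<iota> c 0 (Suc (?h j)) * ?P j"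
    if j: "j \<in> {1..n}" for j
  proof -
    let ?f = "f(Suc n := j)"
    have "{i \<in> {2..Suc n}. ?f i = Suc n} = {}"
      using j parent_mapsD[OF assms(3)] by (auto simp: le_Suc_eq) fastforce
    then have 1: "card {i \<in> {2..Suc n}. ?f i = Suc n} = 0"
      by (metis card.empty)
    have 2: "depth ?f (Suc n) = ?h j"
      using j by (subst depth.simps) (simp add: depth_fun_upd)
    have 3: "card {l \<in> {2..Suc n}. ?f l = i} = (?s(j := Suc (?s j))) i" for i
    proof -
      have "{l \<in> {2..Suc n}. ?f l = i} =
          (if i = j then insert (Suc n) else id) {l \<in> {2..n}. f l = i}"
        using assms(2) by auto
      then show ?thesis by auto
    qed
    have "tree_prod \<iota> c (Suc n) ?f =
        egf_at \<iota> c (card {l \<in> {2..Suc n}. ?f l = Suc n}) (Suc (depth ?f (Suc n))) *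
        (\<Prod>i\<in>{1..n}. egf_at \<iota> c (card {l \<in> {2..Suc n}. ?f l = i}) (Suc (depth ?f i)))"
      unfolding tree_prod_def by (subst prod.cl_ivl_Suc) (simp add: mult.commute del: fun_upd_apply)
    also have "\<dots> = egf_at \<iota> c 0 (Suc (?h j)) * ?P j"
      unfolding 1 2 3
      by (intro arg_cong2[of _ _ _ _ "(*)"] prod.cong refl) (simp add: depth_fun_upd del: fun_upd_apply)
    finally show ?thesis .
  qed
  have "D_op (egf \<iota> c) (Suc n) (tree_prod \<iota> c n f) =
      (\<Sum>k<Suc n. \<Sum>j\<in>{j \<in> {1..n}. ?h j = k}. egf_at \<iota> c 0 (Suc k) * ?P j)"
    unfolding D_op_def tree_prod_def mfps_deriv_prod_egf_at[OF assms(1) finite_atLeastAtMost]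
    by (simp add: egf_at_def sum_distrib_left)
  also have "\<dots> = (\<Sum>k<Suc n. \<Sum>j\<in>{j \<in> {1..n}. ?h j = k}. egf_at \<iota> c 0 (Suc (?h j)) * ?P j)"
    by (intro sum.cong) auto
  also have "\<dots> = (\<Sum>j\<in>{1..n}. egf_at \<iota> c 0 (Suc (?h j)) * ?P j)"
  \<comment> \<open>Every \<open>?h j\<close> lies in the range of \<open>k\<close>; the index
    \<open>k = 0\<close> has an empty fibre.\<close>
  proof (rule sum.group)
    have "Suc (depth f j) < Suc n" if "j \<in> {1..n}" for j
      using that depth_less[of j f] by auto
    then show "?h ` {1..n} \<subseteq> {..<Suc n}" by blast
  qed auto
  finally show ?thesis
    using step by simp
qed

lemma mfps_deriv_X: "mfps_deriv k (mfps_X k) = 1"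
proof (rule mfps_eqI)
  fix m :: "nat \<Rightarrow>\<^sub>0 nat"
  have "m + Poly_Mapping.single k 1 = Poly_Mapping.single k 1 \<longleftrightarrow> m = 0"
    by simp
  then show "mfps_nth (mfps_deriv k (mfps_X k)) m = mfps_nth (1::'a mfps) m"
    by (simp add: mfps_deriv_def mfps_X_def one_mfps_def)
qed

lemma Delta_op_X_eq_sum_tree_prod:
  assumes "rat_embedding \<iota>" "n \<ge> 1"
  shows "Delta_op (egf \<iota> c) n (mfps_X 0) = (\<Sum>f\<in>parent_maps n. tree_prod \<iota> c n f)"
  using assms(2)
proof (induction n rule: dec_induct)
  \<comment> \<open>Here the series is \<phi> in the variable with index 1, the factor of a root
    without internal children.\<close>
  case base
  show ?case
    by (simp add: D_op_def mfps_deriv_X parent_maps_def tree_prod_def egf_at_def)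
next
  case (step n)
  have "Delta_op (egf \<iota> c) (Suc n) (mfps_X 0) =
      (\<Sum>f\<in>parent_maps n. \<Sum>j\<in>{1..n}. tree_prod \<iota> c (Suc n) (f(Suc n := j)))"
    using step by (simp add: D_op_sum D_op_tree_prod[OF assms(1)])
  also have "\<dots> = (\<Sum>j\<in>{1..<Suc n}. \<Sum>f\<in>parent_maps n. tree_prod \<iota> c (Suc n) (f(Suc n := j)))"
    by (subst sum.swap) (simp add: atLeastLessThanSuc_atLeastAtMost)
  also have "\<dots> = (\<Sum>f\<in>PiE (insert (Suc n) {2..n}) (\<lambda>i. {1..<i}). tree_prod \<iota> c (Suc n) f)"
    unfolding parent_maps_def by (rule sum_PiE_insert[symmetric]) simp
  also have "insert (Suc n) {2..n} = {2..Suc n}"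
    using step by auto
  finally show ?case
    unfolding parent_maps_def .
qed

subsection \<open>Increasing trees as pairs of parent functions\<close>

definition tree_edges ::
  "nat \<Rightarrow> 'b set \<Rightarrow> (nat \<Rightarrow> nat) \<Rightarrow> ('b \<Rightarrow> nat) \<Rightarrow> ((nat + 'b) \<times> (nat + 'b)) set" where
  "tree_edges n V f g =
     (\<lambda>j. (Inl (f j), Inl j)) ` {2..n} \<union> (\<lambda>v. (Inl (g v), Inr v)) ` V"

lemma tree_edges_iff [simp]:
  "(Inl i, Inl j) \<in> tree_edges n V f g \<longleftrightarrow> j \<in> {2..n} \<and> f j = i"
  "(Inl i, Inr v) \<in> tree_edges n V f g \<longleftrightarrow> v \<in> V \<and> g v = i"
  "(Inr w, y) \<notin> tree_edges n V f g"
  by (auto simp: tree_edges_def)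

lemma tree_edges_sourceD:
  "(x, Inl j) \<in> tree_edges n V f g \<Longrightarrow> x = Inl (f j)"
  "(x, Inr v) \<in> tree_edges n V f g \<Longrightarrow> x = Inl (g v)"
  by (auto simp: tree_edges_def)

text \<open>The summands are the order of the derivative in \<open>tree_prod\<close> and the number
  of leaves added by the coefficient extraction.\<close>

lemma card_children_tree_edges:
  assumes "finite V"
  shows "card (children (tree_edges n V f g) (Inl i)) =
    card {j \<in> {2..n}. f j = i} + card {v \<in> V. g v = i}"
proof -
  have "children (tree_edges n V f g) (Inl i) = {j \<in> {2..n}. f j = i} <+> {v \<in> V. g v = i}"
    by (auto simp: children_def tree_edges_def)
  then show ?thesis
    using assms by (simp add: card_Plus)
qed

text \<open>No edge enters the root and only one enters any other internal vertex, so the way back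
  to the root is forced. Controlling every length \<open>h\<close> makes the \<open>LEAST\<close> in
  \<open>height\<close> immediate.\<close>

lemma root_relpow_internal_iff:
  assumes "f \<in> parent_maps n" "i \<in> {1..n}"
  shows "(Inl 1, Inl i) \<in> tree_edges n V f g ^^ h \<longleftrightarrow> h = depth f i"
  using assms(2)
proof (induction i arbitrary: h rule: less_induct)
  case (less i)
  show ?case
  proof (cases "i = 1")
    case True
    then show ?thesis
      by (cases h) (auto simp: tree_edges_def)
  next
    case False
    then have i: "i \<in> {2..n}" using less.prems by auto
    note f = parent_mapsD[OF assms(1) i]
    show ?thesis
    proof (cases h)
      case 0
      then show ?thesis
        using False depth_parent[OF assms(1) i] by simp
    next
      case (Suc h')
      have "(Inl 1, Inl i) \<in> tree_edges n V f g ^^ h \<longleftrightarrow>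
          (Inl 1, Inl (f i)) \<in> tree_edges n V f g ^^ h'"
        using i unfolding Suc relpow.simps by (auto dest: tree_edges_sourceD)
      also have "\<dots> \<longleftrightarrow> h' = depth f (f i)"
        using f i by (intro less.IH) auto
      finally show ?thesis
        using Suc depth_parent[OF assms(1) i] by simp
    qed
  qed
qed

lemma root_relpow_leaf_iff:
  assumes "f \<in> parent_maps n" "v \<in> V" "g v \<in> {1..n}"
  shows "(Inl 1, Inr v) \<in> tree_edges n V f g ^^ h \<longleftrightarrow> h = Suc (depth f (g v))"
proof (cases h)
  case (Suc h')
  have "(Inl 1, Inr v) \<in> tree_edges n V f g ^^ h \<longleftrightarrow>
      (Inl 1, Inl (g v)) \<in> tree_edges n V f g ^^ h'"
    using assms(2) unfolding Suc relpow.simps by (auto dest: tree_edges_sourceD)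
  then show ?thesis
    using root_relpow_internal_iff[OF assms(1,3)] Suc by simp
qed simp

lemma height_leaf_tree_edges:
  assumes "f \<in> parent_maps n" "v \<in> V" "g v \<in> {1..n}"
  shows "height (Inl 1) (tree_edges n V f g) (Inr v) = Suc (depth f (g v))"
  unfolding height_def root_relpow_leaf_iff[of f n v V g, OF assms]
  by (rule Least_equality) simp_all

lemma tree_edges_trancl_internal:
  assumes "f \<in> parent_maps n" "(Inl i, Inl j) \<in> (tree_edges n V f g)\<^sup>+"
  shows "i < j"
proof -
  \<comment> \<open>The induction over paths needs a claim about every endpoint. It is void at
    leaves, from which no edge continues.\<close>
  have "case y of Inl j \<Rightarrow> i < j | Inr _ \<Rightarrow> True" if "(Inl i, y) \<in> (tree_edges n V f g)\<^sup>+" for y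
    using that
  proof (induction rule: trancl_induct)
    case (base y)
    then show ?case
      using parent_mapsD[OF assms(1)] by (auto simp: tree_edges_def)
  next
    case (step y z)
    then show ?case
      using parent_mapsD[OF assms(1)]
      by (auto simp: tree_edges_def) (metis atLeastAtMost_iff less_trans)
  qed
  from this[OF assms(2)] show ?thesis by simp
qed

lemma increasing_tree_tree_edges:
  assumes "n \<ge> 1" "f \<in> parent_maps n" "g \<in> V \<rightarrow> {1..n}"
  shows "increasing_tree n V (Inl 1) (tree_edges n V f g)"
proof -
  let ?E = "tree_edges n V f g"
  have f: "1 \<le> f i" "f i \<le> n" if "i \<in> {2..n}" for i
    using parent_mapsD[OF assms(2) that] that by auto
  have sub: "?E \<subseteq> ({1..n} <+> V) \<times> ({1..n} <+> V)"
    using f assms(3) by (auto simp: tree_edges_def)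
  have root: "(y, Inl 1) \<notin> ?E" for y
    by (auto simp: tree_edges_def)
  have parent: "\<exists>!y. (y, x) \<in> ?E" if "x \<in> ({1..n} <+> V) - {Inl 1}" for x
    using that
  proof (elim DiffE PlusE)
    fix i assume "x = Inl i" "i \<in> {1..n}" "x \<notin> {Inl 1}"
    then show ?thesis
      by (intro ex1I[of _ "Inl (f i)"]) (auto dest: tree_edges_sourceD)
  next
    fix v assume "x = Inr v" "v \<in> V"
    then show ?thesis
      by (intro ex1I[of _ "Inl (g v)"]) (auto dest: tree_edges_sourceD)
  qed
  have reach: "(Inl 1, x) \<in> ?E\<^sup>*" if "x \<in> {1..n} <+> V" for x
    using that
  proof (rule PlusE)
    fix i assume "x = Inl i" "i \<in> {1..n}"
    then have "(Inl 1, x) \<in> ?E ^^ depth f i"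
      using root_relpow_internal_iff[OF assms(2)] by blast
    then show ?thesis
      by (rule relpow_imp_rtrancl)
  next
    fix v assume v: "x = Inr v" "v \<in> V"
    then have "(Inl 1, x) \<in> ?E ^^ Suc (depth f (g v))"
      using root_relpow_leaf_iff[of f n v V g] assms(2,3) by blast
    then show ?thesis
      by (rule relpow_imp_rtrancl)
  qed
  have leaf: "children ?E (Inr v) = {}" for v
    by (simp add: children_def)
  have incr: "i < j" if "(Inl i, Inl j) \<in> ?E\<^sup>+" for i j
    using assms(2) that by (rule tree_edges_trancl_internal)
  have one: "Inl 1 \<in> {1..n} <+> V" "Inl 1 \<in> Inl ` {1..n}"
    using assms(1) by auto
  show ?thesis
    unfolding increasing_tree_def rooted_tree_def
    by (intro conjI ballI allI impI sub root parent reach leaf one) (assumption | rule incr)+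
qed

text \<open>Leaves are childless, so the unique parents are internal and define \<open>f\<close> and
  \<open>g\<close>; the increase along edges confines \<open>f j\<close> to labels below
  \<open>j\<close>.\<close>

lemma increasing_tree_cases:
  assumes "increasing_tree n V r E"
  obtains f g where "f \<in> parent_maps n" "g \<in> V \<rightarrow>\<^sub>E {1..n}" "r = Inl 1" "E = tree_edges n V f g"
proof -
  let ?X = "{1..n} <+> V"
  have E: "E \<subseteq> ?X \<times> ?X" and root: "\<And>y. (y, r) \<notin> E"
    and parent: "\<And>x. x \<in> ?X - {r} \<Longrightarrow> \<exists>!y. (y, x) \<in> E"
    and reach: "\<And>x. x \<in> ?X \<Longrightarrow> (r, x) \<in> E\<^sup>*"
    and leaf: "\<And>v. v \<in> V \<Longrightarrow> children E (Inr v) = {}"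
    and incr: "\<And>i j. (Inl i, Inl j) \<in> E\<^sup>+ \<Longrightarrow> i < j"
    using assms unfolding increasing_tree_def rooted_tree_def by blast+
  obtain i where i: "r = Inl i" "i \<in> {1..n}"
    using assms unfolding increasing_tree_def by blast
  \<comment> \<open>The vertex with label 1 is reachable from the root, so any other root would have
    a label below 1.\<close>
  have r: "r = Inl 1"
  proof (rule ccontr)
    assume "r \<noteq> Inl 1"
    moreover have "(r, Inl 1) \<in> E\<^sup>*"
      using i by (intro reach) auto
    ultimately have "(r, Inl 1) \<in> E\<^sup>+"
      by (metis rtranclD)
    then show False
      using incr[of i 1] i by simp
  qed
  have src: "\<exists>i\<in>{1..n}. x = Inl i" if "(x, y) \<in> E" for x y
    using that E leaf by (cases x) (auto simp: children_def)
  have "\<exists>i. i \<in> {1..n} \<and> (Inl i, x) \<in> E \<and> (\<forall>y. (y, x) \<in> E \<longrightarrow> y = Inl i)" if "x \<in> ?X - {r}" for x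
    using parent[OF that] src by blast
  then obtain p where p: "\<And>x. x \<in> ?X - {r} \<Longrightarrow> p x \<in> {1..n} \<and> (Inl (p x), x) \<in> E"
    and uniq: "\<And>x y. x \<in> ?X - {r} \<Longrightarrow> (y, x) \<in> E \<Longrightarrow> y = Inl (p x)"
    by metis
  \<comment> \<open>Restriction fixes the values outside the domains, so that a tree determines its
    pair of functions.\<close>
  define f where "f = restrict (\<lambda>j. p (Inl j)) {2..n}"
  define g where "g = restrict (\<lambda>v. p (Inr v)) V"
  have "f \<in> parent_maps n"
    unfolding parent_maps_def
  proof (rule PiE_I)
    fix j assume j: "j \<in> {2..n}"
    then have "p (Inl j) \<in> {1..n} \<and> (Inl (p (Inl j)), Inl j) \<in> E"
      using r by (intro p) auto
    then show "f j \<in> {1..<j}"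
      using incr[of "p (Inl j)" j] j by (auto simp: f_def)
  qed (auto simp: f_def)
  moreover have "g \<in> V \<rightarrow>\<^sub>E {1..n}"
  proof (rule PiE_I)
    fix v assume "v \<in> V"
    then show "g v \<in> {1..n}"
      using p[of "Inr v"] r by (auto simp: g_def)
  qed (auto simp: g_def)
  moreover have "E = tree_edges n V f g"
  proof (intro equalityI subrelI)
    fix x y assume xy: "(x, y) \<in> E"
    then have y: "y \<in> ?X - {r}"
      using E root by auto
    from uniq[OF y xy] y r show "(x, y) \<in> tree_edges n V f g"
      by (auto simp: f_def g_def)
  next
    fix x y assume "(x, y) \<in> tree_edges n V f g"
    moreover have "(Inl (p (Inl j)), Inl j) \<in> E" if "j \<in> {2..n}" for j
      using r that by (intro conjunct2[OF p]) auto
    moreover have "(Inl (p (Inr v)), Inr v) \<in> E" if "v \<in> V" for v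
      using r that by (intro conjunct2[OF p]) auto
    ultimately show "(x, y) \<in> E"
      by (auto simp: tree_edges_def f_def g_def)
  qed
  ultimately show thesis
    using that r by blast
qed

text \<open>For fixed \<open>f\<close>, prescribing the height of a leaf amounts to hanging it on a
  vertex of depth one less, which is the choice offered by the coefficient extraction. The edges
  recover \<open>f\<close> and \<open>g\<close> on their domains, and extensionality does the
  rest.\<close>

lemma bij_betw_tree_edges:
  assumes "n \<ge> 1"
  shows "bij_betw (\<lambda>(f, g). (Inl 1, tree_edges n V f g))
    (SIGMA f:parent_maps n. PiE V (\<lambda>v. {i \<in> {1..n}. Suc (depth f i) = \<kappa> v}))
    (increasing_trees_with_heights n V \<kappa>)"
  (is "bij_betw ?F ?A ?B")
proof (rule bij_betwI')
  fix x y assume xy: "x \<in> ?A" "y \<in> ?A"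
  obtain f g f' g' where fg: "x = (f, g)" "y = (f', g')"
    by (cases x, cases y)
  have "f = f'" "g = g'" if eq: "tree_edges n V f g = tree_edges n V f' g'"
  proof -
    have ext: "f \<in> extensional {2..n}" "f' \<in> extensional {2..n}"
        "g \<in> extensional V" "g' \<in> extensional V"
      using xy by (auto simp: fg parent_maps_def PiE_iff)
    have "f j = f' j" if "j \<in> {2..n}" for j
      using eq that by (metis tree_edges_iff(1))
    moreover have "g v = g' v" if "v \<in> V" for v
      using eq that by (metis tree_edges_iff(2))
    ultimately show "f = f'" "g = g'"
      using ext by (auto intro: extensionalityI)
  qed
  then show "(?F x = ?F y) = (x = y)"
    by (auto simp: fg)
next
  fix x assume x: "x \<in> ?A"
  obtain f g where fg: "x = (f, g)" by (cases x)
  have f: "f \<in> parent_maps n" and g: "\<And>v. v \<in> V \<Longrightarrow> g v \<in> {1..n} \<and> Suc (depth f (g v)) = \<kappa> v"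
    using x by (auto simp: fg dest: PiE_mem)
  have "height (Inl 1) (tree_edges n V f g) (Inr v) = \<kappa> v" if "v \<in> V" for v
    using height_leaf_tree_edges[of f n v V g] f g[OF that] that by simp
  then show "?F x \<in> ?B"
    using increasing_tree_tree_edges[OF assms f, of g V] g
    by (auto simp: fg increasing_trees_with_heights_def)
next
  fix y assume y: "y \<in> ?B"
  obtain r E where rE: "y = (r, E)" by (cases y)
  then have tree: "increasing_tree n V r E" and ht: "\<And>v. v \<in> V \<Longrightarrow> height r E (Inr v) = \<kappa> v"
    using y by (auto simp: increasing_trees_with_heights_def)
  obtain f g where fg: "f \<in> parent_maps n" "g \<in> V \<rightarrow>\<^sub>E {1..n}" "r = Inl 1" "E = tree_edges n V f g"
    using increasing_tree_cases[OF tree] by blast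
  have "g \<in> PiE V (\<lambda>v. {i \<in> {1..n}. Suc (depth f i) = \<kappa> v})"
  proof (rule PiE_I)
    fix v assume v: "v \<in> V"
    then have "g v \<in> {1..n}" using PiE_mem[OF fg(2)] by blast
    then show "g v \<in> {i \<in> {1..n}. Suc (depth f i) = \<kappa> v}"
      using height_leaf_tree_edges[of f n v V g] v ht[OF v] fg by simp
  qed (rule PiE_arb[OF fg(2)])
  then show "\<exists>x\<in>?A. y = ?F x"
    using fg rE by (intro bexI[of _ "(f, g)"]) auto
qed

section \<open>Coefficients of the sum over trees\<close>

theorem proposition1:
  fixes \<iota> :: "rat \<Rightarrow> 'a::comm_ring_1"
    and \<phi>c :: "nat \<Rightarrow> 'a"
    and \<phi> :: "'a fps"
    and n :: nat
    and \<T> :: "'a mfps"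
  assumes "rat_embedding \<iota>"
    and "\<phi> = egf \<iota> \<phi>c"
    and "n \<ge> 1"
    and "\<T> = Delta_op \<phi> n (mfps_X 0)"
  shows "\<T> \<in> mfps_in {1..n} \<and>
    (\<forall>k (V :: 'b set) \<kappa>.
       Poly_Mapping.keys k \<subseteq> {1..n} \<and>
       finite V \<and> \<kappa> \<in> V \<rightarrow> {1..n} \<and>
       (\<forall>i\<in>{1..n}. card {v \<in> V. \<kappa> v = i} = Poly_Mapping.lookup k i) \<longrightarrow>
       mfps_egf_coeff \<T> k =
         (\<Sum>(r, E) \<in> increasing_trees_with_heights n V \<kappa>.
            \<Prod>v\<in>{1..n}. \<phi>c (card (children E (Inl v)))))"
proof (intro conjI allI impI)
  have \<T>: "\<T> = (\<Sum>f\<in>parent_maps n. tree_prod \<iota> \<phi>c n f)"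
    unfolding assms(4,2) by (rule Delta_op_X_eq_sum_tree_prod[OF assms(1,3)])
  have "Suc (depth f i) \<in> {1..n}" if "i \<in> {1..n}" for f i
    using that depth_less[of i f] by auto
  then show "\<T> \<in> mfps_in {1..n}"
    unfolding \<T> tree_prod_def egf_at_def by (intro mfps_in_sum mfps_in_prod fps_at_X_in)
  fix k and V :: "'b set" and \<kappa>
  assume *: "Poly_Mapping.keys k \<subseteq> {1..n} \<and> finite V \<and> \<kappa> \<in> V \<rightarrow> {1..n} \<and>
    (\<forall>i\<in>{1..n}. card {v \<in> V. \<kappa> v = i} = Poly_Mapping.lookup k i)"
  then have V: "finite V" by blast
  \<comment> \<open>The count extends to all indices: outside \<open>{1..n}\<close> there are
    neither colors nor exponents.\<close>
  have k: "card {v \<in> V. \<kappa> v = i} = Poly_Mapping.lookup k i" for i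
  proof (cases "i \<in> {1..n}")
    case False
    then have "{v \<in> V. \<kappa> v = i} = {}" "Poly_Mapping.lookup k i = 0"
      using * by (auto simp: in_keys_iff)
    then show ?thesis by (metis card.empty)
  qed (use * in blast)
  let ?G = "\<lambda>f. PiE V (\<lambda>v. {i \<in> {1..n}. Suc (depth f i) = \<kappa> v})"
  let ?w = "\<lambda>E. \<Prod>v\<in>{1..n}. \<phi>c (card (children E (Inl v)))"
  have fin: "finite (parent_maps n)" "finite (?G f)" for f
    using V by (auto simp: parent_maps_def intro: finite_PiE)
  have "mfps_egf_coeff \<T> k = (\<Sum>f\<in>parent_maps n. mfps_egf_coeff (tree_prod \<iota> \<phi>c n f) k)"
    by (simp add: \<T> mfps_egf_coeff_def mfps_nth_sum sum_distrib_left)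
  also have "\<dots> = (\<Sum>f\<in>parent_maps n. \<Sum>g\<in>?G f. ?w (tree_edges n V f g))"
    unfolding tree_prod_def mfps_egf_coeff_prod_egf_at[OF assms(1) finite_atLeastAtMost V k]
      card_children_tree_edges[OF V] ..
  also have "\<dots> = (\<Sum>(f, g)\<in>(SIGMA f:parent_maps n. ?G f). ?w (tree_edges n V f g))"
    using fin by (intro sum.Sigma) auto
  also have "\<dots> = (\<Sum>(r, E)\<in>increasing_trees_with_heights n V \<kappa>. ?w E)"
    by (subst sum.reindex_bij_betw[OF bij_betw_tree_edges[OF assms(3)], symmetric])
      (simp add: case_prod_unfold)
  finally show "mfps_egf_coeff \<T> k = (\<Sum>(r, E)\<in>increasing_trees_with_heights n V \<kappa>. ?w E)" .
qed

end
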